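(* Let $\Theta_* \le f_*$ (weak duality) and let $\{(x_n,\mu_n)\}$ be a sequence generated by the inexact primal-dual method with tolerances $\{\varepsilon_n\}$; put $\varepsilon_* = \limsup_{n\to\infty}\varepsilon_n$. Suppose that \[ \lim_{n\to\infty}\operatorname{dist}(0,\Phi(x_n)) = 0, \qquad \liminf_{n\to\infty}\varphi(x_n,\mu_n)\ge 0 . \] Then \[ \underline{\vartheta}_* \le \liminf_{n\to\infty} f(x_n)\le\limsup_{n\to\infty} f(x_n)\le\overline{\vartheta}_*+\varepsilon_*, \] \[ \underline{\vartheta}_* \le \liminf_{n\to\infty} F(x_n,\mu_n)\le\limsup_{n\to\infty} F(x_n,\mu_n)\le\overline{\vartheta}_*+\varepsilon_*, \] \[ \underline{\vartheta}_*-\varepsilon_* \le \liminf_{n\to\infty}\Theta(\mu_n)\le\limsup_{n\to\infty}\Theta(\mu_n)\le\overline{\vartheta}_*, \] where $\underline{\vartheta}_*=\min\{f_*,\liminf_{y\to 0}\beta(y)\}$, $\overline{\vartheta}_*=\underline{\vartheta}_*$ if the sequence $\{\mu_n\}$ satisfies the $\varphi$-convergence to zero condition, and $\overline{\vartheta}_*=f_*$ otherwise. In addition, if the optimal value function $\beta$ is lower semicontinuous at the origin, then $\underline{\vartheta}_*=\overline{\vartheta}_*=f_*$, $\limsup_{n\to\infty}\varphi(x_n,\mu_n)\le\varepsilon_*$, and the following two statements hold: (1) if the functions $f$ and $\operatorname{dist}(0,\Phi(\cdot))$ are lower semicontinuous on $Q$ and $\Phi$ takes closed values on $Q$, then any limit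 point of $\{x_n\}$ (if such a point exists) is an $\varepsilon_*$-optimal solution of problem $(\mathcal{P})$; (2) if $\Theta$ is upper semicontinuous, then any limit point of $\{\mu_n\}$ (if such a point exists) is an $\varepsilon_*$-optimal solution of the dual problem $(\mathcal{D})$.
   Context: Setting. $(X,d_X)$ is a metric space, $Y$ is a normed space, $Q\subset X$ is a nonempty closed set, $f\colon X\to\mathbb{R}\cup\{+\infty\}$, and $\Phi\colon X\rightrightarrows Y$ is a set-valued map. Problem $(\mathcal{P})$: minimize $f(x)$ subject to $0\in\Phi(x)$, $x\in Q$. Its feasible region is assumed nonempty and its optimal value $f_*$ is assumed finite. $(M,d_M)$ is a metric space, $\varphi\colon X\times M\to(-\infty,+\infty]$ is a given function, and $F(x,\mu)=f(x)+\varphi(x,\mu)$. The dual function is $\Theta(\mu)=\inf_{x\in Q}F(x,\mu)$; the dual problem $(\mathcal{D})$ is to maximize $\Theta(\mu)$ over $\mu\in M$, with optimal value $\Theta_*=\sup_{\mu\in M}\Theta(\mu)$. $\operatorname{dist}(0,\Phi(x))=\inf_{y\in\Phi(x)}\|y\|$ ($=+\infty$ if $\Phi(x)=\emptyset$). The optimal value function is $\beta(y)=\inf\{f(x)\mid x\in Q,\ 0\in\Phi(x)-y\}$, $y\in Y$ (with $\inf\emptyset=+\infty$), so $\beta(0)=f_*$; lower semicontinuity at the origin means $\beta(0)\le\liminf_{y\to0}\beta(y)$. Inexact primal-dual method: $\{\varepsilon_n\}\subset[0,+\infty)$ is a sequence that is bounded above; for each $n\in\mathbb{N}$, $\mu_n\in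 M$ is chosen arbitrarily and $x_n\in Q$ satisfies $F(x_n,\mu_n)\le F(x,\mu_n)+\varepsilon_n$ for all $x\in Q$. Standing assumption: for every $n$ the function $F(\cdot,\mu_n)$ is bounded below on $Q$. $\varphi$-convergence to zero condition: a sequence $\{\mu_n\}\subset M$ satisfies it if there exists $\{t_n\}\subset(0,+\infty)$ such that for any sequence $\{z_n\}\subset Q$ with $\operatorname{dist}(0,\Phi(z_n))\le t_n$ for all $n$ one has $\limsup_{n\to\infty}\varphi(z_n,\mu_n)\le0$. A limit point of a sequence is the limit of some convergent subsequence. For $\varepsilon\ge0$, an $\varepsilon$-optimal solution of $(\mathcal{P})$ is a feasible $x$ with $f(x)\le f_*+\varepsilon$; an $\varepsilon$-optimal solution of $(\mathcal{D})$ is $\mu\in M$ with $\Theta(\mu)\ge\Theta_*-\varepsilon$. *)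

theory Defs
  imports "HOL-Analysis.Analysis"
begin

text \<open>
  Values in \<open>[-\<infinity>, +\<infinity>]\<close> are modelled by \<^typ>\<open>ereal\<close>, a complete lattice, so that
  \<open>INF x\<in>{}. g x = \<infinity>\<close>.
\<close>

text \<open>The library's \<open>infdist\<close> is real-valued and equals \<open>0\<close> on the empty set; here the distance to
  the empty set has to be \<open>\<infinity>\<close>.\<close>

definition dist_zero :: "'b::real_normed_vector set \<Rightarrow> ereal" where
  "dist_zero A = (INF y\<in>A. ereal (norm y))"

definition feasible_set :: "'a set \<Rightarrow> ('a \<Rightarrow> 'b::real_normed_vector set) \<Rightarrow> 'a set" where
  "feasible_set Q \<Phi> = {x \<in> Q. 0 \<in> \<Phi> x}"

definition opt_value :: "('a \<Rightarrow> ereal) \<Rightarrow> 'a set \<Rightarrow> ('a \<Rightarrow> 'b::real_normed_vector set) \<Rightarrow> ereal" where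
  "opt_value f Q \<Phi> = (INF x\<in>feasible_set Q \<Phi>. f x)"

definition perturbed_value ::
    "('a \<Rightarrow> ereal) \<Rightarrow> 'a set \<Rightarrow> ('a \<Rightarrow> 'b::real_normed_vector set) \<Rightarrow> 'b \<Rightarrow> ereal" where
  "perturbed_value f Q \<Phi> y = (INF x\<in>{x \<in> Q. 0 \<in> (\<lambda>z. z - y) ` \<Phi> x}. f x)"

definition aug_fun :: "('a \<Rightarrow> ereal) \<Rightarrow> ('a \<Rightarrow> 'm \<Rightarrow> ereal) \<Rightarrow> 'a \<Rightarrow> 'm \<Rightarrow> ereal" where
  "aug_fun f \<phi> x \<mu> = f x + \<phi> x \<mu>"

definition dual_fun :: "('a \<Rightarrow> ereal) \<Rightarrow> 'a set \<Rightarrow> ('a \<Rightarrow> 'm \<Rightarrow> ereal) \<Rightarrow> 'm \<Rightarrow> ereal" where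
  "dual_fun f Q \<phi> \<mu> = (INF x\<in>Q. aug_fun f \<phi> x \<mu>)"

definition dual_value :: "('a \<Rightarrow> ereal) \<Rightarrow> 'a set \<Rightarrow> ('a \<Rightarrow> 'm \<Rightarrow> ereal) \<Rightarrow> ereal" where
  "dual_value f Q \<phi> = (SUP \<mu>. dual_fun f Q \<phi> \<mu>)"

definition eps_optimal_primal ::
    "('a \<Rightarrow> ereal) \<Rightarrow> 'a set \<Rightarrow> ('a \<Rightarrow> 'b::real_normed_vector set) \<Rightarrow> ereal \<Rightarrow> 'a \<Rightarrow> bool" where
  "eps_optimal_primal f Q \<Phi> e x \<longleftrightarrow> x \<in> feasible_set Q \<Phi> \<and> f x \<le> opt_value f Q \<Phi> + e"

definition eps_optimal_dual ::
    "('a \<Rightarrow> ereal) \<Rightarrow> 'a set \<Rightarrow> ('a \<Rightarrow> 'm \<Rightarrow> ereal) \<Rightarrow> ereal \<Rightarrow> 'm \<Rightarrow> bool" where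
  "eps_optimal_dual f Q \<phi> e \<mu> \<longleftrightarrow> dual_fun f Q \<phi> \<mu> \<ge> dual_value f Q \<phi> - e"

text \<open>\<open>at x within S\<close> is the punctured neighbourhood filter. As \<open>x\<close> itself imposes nothing in these
  inequalities, they agree with the versions over full neighbourhoods; at an isolated point of \<open>S\<close>
  they hold trivially.\<close>

definition lsc_within :: "('a::topological_space \<Rightarrow> ereal) \<Rightarrow> 'a \<Rightarrow> 'a set \<Rightarrow> bool" where
  "lsc_within g x S \<longleftrightarrow> g x \<le> Liminf (at x within S) g"

definition usc_within :: "('a::topological_space \<Rightarrow> ereal) \<Rightarrow> 'a \<Rightarrow> 'a set \<Rightarrow> bool" where
  "usc_within g x S \<longleftrightarrow> Limsup (at x within S) g \<le> g x"

definition lsc_on :: "'a::topological_space set \<Rightarrow> ('a \<Rightarrow> ereal) \<Rightarrow> bool" where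
  "lsc_on S g \<longleftrightarrow> (\<forall>x\<in>S. lsc_within g x S)"

definition usc_on :: "'a::topological_space set \<Rightarrow> ('a \<Rightarrow> ereal) \<Rightarrow> bool" where
  "usc_on S g \<longleftrightarrow> (\<forall>x\<in>S. usc_within g x S)"

definition seq_limit_point :: "(nat \<Rightarrow> 'a::topological_space) \<Rightarrow> 'a \<Rightarrow> bool" where
  "seq_limit_point s l \<longleftrightarrow> (\<exists>r. strict_mono r \<and> (s \<circ> r) \<longlonglongrightarrow> l)"

text \<open>Boundedness below is by a real constant: \<open>bdd_below\<close> would be vacuous on \<^typ>\<open>ereal\<close>.\<close>

definition inexact_primal_dual ::
    "('a \<Rightarrow> ereal) \<Rightarrow> 'a set \<Rightarrow> ('a \<Rightarrow> 'm \<Rightarrow> ereal) \<Rightarrow> (nat \<Rightarrow> real) \<Rightarrow> (nat \<Rightarrow> 'a) \<Rightarrow> (nat \<Rightarrow> 'm) \<Rightarrow> bool"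
  where
  "inexact_primal_dual f Q \<phi> \<epsilon> x \<mu> \<longleftrightarrow>
     (\<forall>n. 0 \<le> \<epsilon> n) \<and> bdd_above (range \<epsilon>) \<and>
     (\<forall>n. \<exists>c::real. \<forall>z\<in>Q. ereal c \<le> aug_fun f \<phi> z (\<mu> n)) \<and>
     (\<forall>n. x n \<in> Q \<and> (\<forall>z\<in>Q. aug_fun f \<phi> (x n) (\<mu> n) \<le> aug_fun f \<phi> z (\<mu> n) + ereal (\<epsilon> n)))"

definition phi_convergence_to_zero ::
    "'a set \<Rightarrow> ('a \<Rightarrow> 'b::real_normed_vector set) \<Rightarrow> ('a \<Rightarrow> 'm \<Rightarrow> ereal) \<Rightarrow> (nat \<Rightarrow> 'm) \<Rightarrow> bool" where
  "phi_convergence_to_zero Q \<Phi> \<phi> \<mu> \<longleftrightarrow>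
     (\<exists>t::nat \<Rightarrow> real. (\<forall>n. 0 < t n) \<and>
        (\<forall>z. (\<forall>n. z n \<in> Q \<and> dist_zero (\<Phi> (z n)) \<le> ereal (t n)) \<longrightarrow>
             limsup (\<lambda>n. \<phi> (z n) (\<mu> n)) \<le> 0))"

definition lower_theta :: "('a \<Rightarrow> ereal) \<Rightarrow> 'a set \<Rightarrow> ('a \<Rightarrow> 'b::real_normed_vector set) \<Rightarrow> ereal" where
  "lower_theta f Q \<Phi> = min (opt_value f Q \<Phi>) (Liminf (at 0) (perturbed_value f Q \<Phi>))"

definition upper_theta ::
    "('a \<Rightarrow> ereal) \<Rightarrow> 'a set \<Rightarrow> ('a \<Rightarrow> 'b::real_normed_vector set) \<Rightarrow> ('a \<Rightarrow> 'm \<Rightarrow> ereal) \<Rightarrow> (nat \<Rightarrow> 'm) \<Rightarrow> ereal"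
  where
  "upper_theta f Q \<Phi> \<phi> \<mu> =
     (if phi_convergence_to_zero Q \<Phi> \<phi> \<mu> then lower_theta f Q \<Phi> else opt_value f Q \<Phi>)"

end

theory Submission
  imports Defs
begin

text \<open>
  Write \<open>\<theta>\<close> for \<^term>\<open>lower_theta f Q \<Phi>\<close>. Everything rests on reading \<open>\<theta>\<close> as the best
  value reachable by almost feasible points: \<open>\<theta>\<close> is the limit, as \<open>\<delta> \<down> 0\<close>, of the infimum of
  \<open>f\<close> over the points \<open>z \<in> Q\<close> with \<open>dist_zero (\<Phi> z) < \<delta>\<close>. Indeed such a point is feasible for some
  perturbation \<open>y\<close> of norm less than \<open>\<delta>\<close>, so \<open>f z\<close> is at least the perturbed value at \<open>y\<close>; the
  minimum with the optimal value in \<open>\<theta>\<close> accounts for \<open>y = 0\<close>. The two halves of this description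
  are \<open>less_lower_thetaD\<close> and \<open>lower_theta_lessD\<close>.

  The first half bounds \<open>liminf f (x n)\<close> from below by \<open>\<theta>\<close>, since each \<open>\<delta>\<close> eventually bounds
  \<open>dist_zero (\<Phi> (x n))\<close>; as \<open>\<phi> (x n) (\<mu> n)\<close> is asymptotically nonnegative, the same bound passes to the
  augmented function \<open>F\<close>, and then, up to the tolerance, to the dual function.

  From above, the values \<open>\<Theta> (\<mu> n)\<close> of the dual function are at most the optimal value by weak
  duality. Under the \<open>\<phi>\<close>-convergence condition they are asymptotically at most \<open>\<theta>\<close>: by the second
  half one can test \<open>\<Theta> (\<mu> n)\<close> with almost feasible points of value close to \<open>\<theta>\<close>, chosen so close to
  feasibility that the contribution of \<open>\<phi>\<close> vanishes. As \<open>x n\<close> almost minimizes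
  \<open>F(\<sqdot>, \<mu> n)\<close>, one has \<open>F (x n) (\<mu> n) \<le> \<Theta> (\<mu> n) + \<epsilon> n\<close>, and removing the asymptotically
  nonnegative term \<open>\<phi> (x n) (\<mu> n)\<close> gives the bound for \<open>f (x n)\<close>.

  If the optimal value function is lower semicontinuous at the origin, then \<open>\<theta>\<close> is the optimal
  value and the two ends of the estimates differ only by the tolerance. Comparing \<open>F\<close> with \<open>f\<close> then
  bounds \<open>\<phi> (x n) (\<mu> n)\<close> by the tolerance, and semicontinuity carries the
  estimates over to limit points.
\<close>

section \<open>Lower and upper limits of extended real functions\<close>

text \<open>The finiteness of \<open>v\<close> makes \<open>u n = (u n + v n) - v n\<close> valid in the extended reals.\<close>

lemma limsup_le_limsup_add_minus_liminf:
  fixes u v :: "nat \<Rightarrow> ereal"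
  assumes "\<And>n. \<bar>v n\<bar> \<noteq> \<infinity>"
  shows "limsup u \<le> limsup (\<lambda>n. u n + v n) - liminf v"
proof -
  have "u n = (u n + v n) + - v n" for n
    using assms[of n] by (cases "u n"; cases "v n") auto
  then have "limsup u = limsup (\<lambda>n. (u n + v n) + - v n)"
    by simp
  also have "\<dots> \<le> limsup (\<lambda>n. u n + v n) + limsup (\<lambda>n. - v n)"
    by (rule ereal_limsup_add_mono)
  finally show ?thesis
    by (simp add: ereal_Limsup_uminus minus_ereal_def)
qed

lemma lsc_within_le_liminf:
  assumes lsc: "lsc_within g l S" and "\<And>n. s n \<in> S" and "s \<longlonglongrightarrow> l"
  shows "g l \<le> liminf (\<lambda>n. g (s n))"
  unfolding le_Liminf_iff
proof (intro allI impI)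
  fix y assume y: "y < g l"
  have "\<forall>\<^sub>F z in at l within S. y < g z"
    using lsc y unfolding lsc_within_def by (intro less_LiminfD) auto
  then have "\<forall>\<^sub>F z in nhds l. z \<in> S \<longrightarrow> y < g z"
    unfolding eventually_at_filter by (rule eventually_mono) (use y in metis)
  then show "\<forall>\<^sub>F n in sequentially. y < g (s n)"
    using assms(2) eventually_compose_filterlim[OF _ assms(3)] by fastforce
qed

lemma usc_within_limsup_le:
  assumes usc: "usc_within g l S" and "\<And>n. s n \<in> S" and "s \<longlonglongrightarrow> l"
  shows "limsup (\<lambda>n. g (s n)) \<le> g l"
proof -
  have "lsc_within (\<lambda>z. - g z) l S"
    using usc by (simp add: lsc_within_def usc_within_def ereal_Liminf_uminus)
  from lsc_within_le_liminf[OF this assms(2,3)] show ?thesis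
    by (simp add: ereal_Liminf_uminus)
qed

section \<open>The lower value and almost feasible points\<close>

lemma dist_zero_le_norm: "y \<in> A \<Longrightarrow> dist_zero A \<le> ereal (norm y)"
  unfolding dist_zero_def by (rule INF_lower)

lemma dist_zero_lessD:
  assumes "dist_zero A < ereal \<delta>"
  obtains y where "y \<in> A" "norm y < \<delta>"
  using assms unfolding dist_zero_def INF_less_iff by auto

lemma closed_dist_zero_le_0D:
  assumes "closed A" and "dist_zero A \<le> 0"
  shows "0 \<in> A"
proof -
  have "\<exists>y\<in>A. dist y 0 < e" if "e > 0" for e
  proof -
    have "dist_zero A < ereal e"
      using assms(2) that by (metis ereal_less(2) order.strict_trans1)
    then show ?thesis
      by (rule dist_zero_lessD) auto
  qed
  then show ?thesis
    using assms(1) closure_approachable closure_closed by blast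
qed

lemma perturbed_value_eq: "perturbed_value f Q \<Phi> y = (INF x\<in>{x \<in> Q. y \<in> \<Phi> x}. f x)"
proof -
  have "0 \<in> (\<lambda>z. z - y) ` A \<longleftrightarrow> y \<in> A" for A
    by force
  then show ?thesis
    unfolding perturbed_value_def by simp
qed

lemma perturbed_value_0: "perturbed_value f Q \<Phi> 0 = opt_value f Q \<Phi>"
  by (simp add: perturbed_value_eq opt_value_def feasible_set_def)

lemma lower_theta_eq_opt_value:
  assumes "lsc_within (perturbed_value f Q \<Phi>) 0 UNIV"
  shows "lower_theta f Q \<Phi> = opt_value f Q \<Phi>"
  using assms by (simp add: lsc_within_def lower_theta_def perturbed_value_0)

text \<open>An almost feasible point is feasible for a small perturbation, so its value dominates a nearby
  value of the optimal value function.\<close>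

lemma less_lower_thetaD:
  assumes "c < lower_theta f Q \<Phi>"
  obtains \<delta> :: real where "0 < \<delta>"
    and "\<And>z. z \<in> Q \<Longrightarrow> dist_zero (\<Phi> z) < ereal \<delta> \<Longrightarrow> c < f z"
proof -
  let ?\<beta> = "perturbed_value f Q \<Phi>"
  have "\<forall>\<^sub>F y in at 0. c < ?\<beta> y"
    using assms by (intro less_LiminfD) (simp add: lower_theta_def)
  then have "\<forall>\<^sub>F y in nhds 0. y \<noteq> 0 \<longrightarrow> c < ?\<beta> y"
    by (simp add: eventually_at_filter)
  moreover have "c < ?\<beta> 0"
    using assms by (simp add: lower_theta_def perturbed_value_0)
  then have "c < ?\<beta> y" if "y \<noteq> 0 \<longrightarrow> c < ?\<beta> y" for y
    using that by (cases "y = 0") auto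
  ultimately have "\<forall>\<^sub>F y in nhds 0. c < ?\<beta> y"
    by (rule eventually_mono)
  then obtain \<delta> where \<delta>: "0 < \<delta>" "\<And>y. norm y < \<delta> \<Longrightarrow> c < ?\<beta> y"
    unfolding eventually_nhds_metric by auto
  show thesis
  proof (rule that[OF \<delta>(1)])
    fix z assume z: "z \<in> Q" "dist_zero (\<Phi> z) < ereal \<delta>"
    then obtain y where y: "y \<in> \<Phi> z" "norm y < \<delta>"
      by (auto elim: dist_zero_lessD)
    have "c < ?\<beta> y"
      using \<delta>(2) y(2) by blast
    also have "\<dots> \<le> f z"
      unfolding perturbed_value_eq using z(1) y(1) by (auto intro: INF_lower)
    finally show "c < f z" .
  qed
qed

text \<open>Some perturbation \<open>y\<close> of norm less than \<open>t\<close> has a value below \<open>c\<close>, and the points feasible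
  for it lie within distance \<open>norm y\<close> of feasibility.\<close>

lemma lower_theta_lessD:
  assumes "lower_theta f Q \<Phi> < c" and "0 < (t::real)"
  obtains z where "z \<in> Q" "dist_zero (\<Phi> z) < ereal t" "f z < c"
proof -
  let ?\<beta> = "perturbed_value f Q \<Phi>"
  have "\<exists>y. norm y < t \<and> ?\<beta> y < c"
  proof (rule ccontr)
    assume "\<nexists>y. norm y < t \<and> ?\<beta> y < c"
    then have *: "c \<le> ?\<beta> y" if "norm y < t" for y
      using that not_less by blast
    have "\<forall>\<^sub>F y in at 0. c \<le> ?\<beta> y"
      unfolding eventually_at using assms(2) * by auto
    then have "c \<le> Liminf (at 0) ?\<beta>"
      by (rule Liminf_bounded)
    moreover have "c \<le> opt_value f Q \<Phi>"
      using *[of 0] assms(2) by (simp add: perturbed_value_0)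
    ultimately have "c \<le> lower_theta f Q \<Phi>"
      by (simp add: lower_theta_def)
    with assms(1) show False
      by simp
  qed
  then obtain y z where y: "norm y < t" and z: "z \<in> Q" "y \<in> \<Phi> z" "f z < c"
    unfolding perturbed_value_eq INF_less_iff by auto
  have "dist_zero (\<Phi> z) < ereal t"
    using dist_zero_le_norm[OF z(2)] y by (meson ereal_less_eq(3) less_ereal.simps(1) order.strict_trans1)
  with z show thesis
    by (intro that)
qed

lemma lower_theta_le_liminf:
  assumes "\<And>n. x n \<in> Q" and "(\<lambda>n. dist_zero (\<Phi> (x n))) \<longlonglongrightarrow> 0"
  shows "lower_theta f Q \<Phi> \<le> liminf (\<lambda>n. f (x n))"
  unfolding le_Liminf_iff
proof (intro allI impI)
  fix c assume "c < lower_theta f Q \<Phi>"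
  then obtain \<delta> where \<delta>: "0 < \<delta>" "\<And>z. z \<in> Q \<Longrightarrow> dist_zero (\<Phi> z) < ereal \<delta> \<Longrightarrow> c < f z"
    by (auto elim: less_lower_thetaD)
  have "\<forall>\<^sub>F n in sequentially. dist_zero (\<Phi> (x n)) < ereal \<delta>"
    using assms(2) \<delta>(1) by (intro order_tendstoD(2)) auto
  then show "\<forall>\<^sub>F n in sequentially. c < f (x n)"
    by eventually_elim (use assms(1) \<delta>(2) in auto)
qed

section \<open>Bounds for the dual function\<close>

text \<open>For every \<open>c\<close> above the lower value there are points \<open>z n\<close> of \<open>Q\<close> with \<open>f (z n) < c\<close> within the
  distances \<open>t n\<close> to feasibility that the \<open>\<phi>\<close>-convergence condition provides; testing the dual
  function with them costs at most \<open>c\<close> in the limit.\<close>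

lemma limsup_dual_fun_le_lower_theta:
  fixes f :: "'a \<Rightarrow> ereal" and \<Phi> :: "'a \<Rightarrow> 'b::real_normed_vector set"
  assumes "phi_convergence_to_zero Q \<Phi> \<phi> \<mu>"
  shows "limsup (\<lambda>n. dual_fun f Q \<phi> (\<mu> n)) \<le> lower_theta f Q \<Phi>"
proof (rule dense_ge)
  fix c assume c: "lower_theta f Q \<Phi> < c"
  obtain t :: "nat \<Rightarrow> real" where t: "\<And>n. 0 < t n"
    and vanish: "\<And>z. (\<And>n. z n \<in> Q \<and> dist_zero (\<Phi> (z n)) \<le> ereal (t n)) \<Longrightarrow>
      limsup (\<lambda>n. \<phi> (z n) (\<mu> n)) \<le> 0"
    using assms unfolding phi_convergence_to_zero_def by blast
  have "\<exists>z. z \<in> Q \<and> dist_zero (\<Phi> z) \<le> ereal (t n) \<and> f z \<le> c" for n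
    using lower_theta_lessD[OF c t[of n]] by (metis less_imp_le)
  then obtain z where z: "\<And>n. z n \<in> Q \<and> dist_zero (\<Phi> (z n)) \<le> ereal (t n)"
    and fz: "\<And>n. f (z n) \<le> c"
    by metis
  have "dual_fun f Q \<phi> (\<mu> n) \<le> c + \<phi> (z n) (\<mu> n)" for n
  proof -
    have "dual_fun f Q \<phi> (\<mu> n) \<le> f (z n) + \<phi> (z n) (\<mu> n)"
      unfolding dual_fun_def aug_fun_def using z by (auto intro: INF_lower)
    also have "\<dots> \<le> c + \<phi> (z n) (\<mu> n)"
      by (intro add_right_mono fz)
    finally show ?thesis .
  qed
  then have "limsup (\<lambda>n. dual_fun f Q \<phi> (\<mu> n)) \<le> limsup (\<lambda>n. c + \<phi> (z n) (\<mu> n))"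
    by (intro Limsup_mono always_eventually allI)
  also have "\<dots> \<le> limsup (\<lambda>n. c) + limsup (\<lambda>n. \<phi> (z n) (\<mu> n))"
    by (rule ereal_limsup_add_mono)
  also have "\<dots> \<le> c + 0"
    using vanish[OF z] by (intro add_mono) (auto simp: Limsup_const)
  finally show "limsup (\<lambda>n. dual_fun f Q \<phi> (\<mu> n)) \<le> c"
    by simp
qed

lemma limsup_dual_fun_le_upper_theta:
  assumes "dual_value f Q \<phi> \<le> opt_value f Q \<Phi>"
  shows "limsup (\<lambda>n. dual_fun f Q \<phi> (\<mu> n)) \<le> upper_theta f Q \<Phi> \<phi> \<mu>"
proof (cases "phi_convergence_to_zero Q \<Phi> \<phi> \<mu>")
  case True
  then show ?thesis
    by (simp add: upper_theta_def limsup_dual_fun_le_lower_theta)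
next
  case False
  have "dual_fun f Q \<phi> (\<mu> n) \<le> opt_value f Q \<Phi>" for n
    using assms unfolding dual_value_def by (meson SUP_upper UNIV_I order_trans)
  then show ?thesis
    using False by (auto simp: upper_theta_def intro: Limsup_bounded)
qed

section \<open>The inexact primal-dual method\<close>

lemma inexact_minimizer_le_dual_fun:
  assumes "inexact_primal_dual f Q \<phi> \<epsilon> x \<mu>"
  shows "aug_fun f \<phi> (x n) (\<mu> n) \<le> dual_fun f Q \<phi> (\<mu> n) + ereal (\<epsilon> n)"
proof -
  have "aug_fun f \<phi> (x n) (\<mu> n) - ereal (\<epsilon> n) \<le> dual_fun f Q \<phi> (\<mu> n)"
    unfolding dual_fun_def using assms
    by (intro INF_greatest) (auto simp: inexact_primal_dual_def ereal_minus_le)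
  then show ?thesis
    by (simp add: ereal_minus_le)
qed

lemma inexact_primal_dual_limsup_finite:
  assumes "inexact_primal_dual f Q \<phi> \<epsilon> x \<mu>"
  shows "0 \<le> limsup (\<lambda>n. ereal (\<epsilon> n))" and "limsup (\<lambda>n. ereal (\<epsilon> n)) < \<infinity>"
proof -
  show "0 \<le> limsup (\<lambda>n. ereal (\<epsilon> n))"
    using assms by (intro le_Limsup) (auto simp: inexact_primal_dual_def)
  obtain B where "\<And>n. \<epsilon> n \<le> B"
    using assms unfolding inexact_primal_dual_def bdd_above_def by auto
  then have "limsup (\<lambda>n. ereal (\<epsilon> n)) \<le> ereal B"
    by (intro Limsup_bounded) auto
  then show "limsup (\<lambda>n. ereal (\<epsilon> n)) < \<infinity>"
    by (auto simp: less_top[symmetric])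
qed

text \<open>A dual function bounded above keeps \<open>F (x n) (\<mu> n)\<close> below \<open>\<infinity>\<close>, which excludes \<open>\<infinity>\<close> for both
  of its summands; \<open>-\<infinity>\<close> is excluded by assumption.\<close>

lemma inexact_primal_dual_finite:
  assumes "\<And>z. f z \<noteq> -\<infinity>" and "\<And>z \<nu>. \<phi> z \<nu> \<noteq> -\<infinity>"
    and "dual_value f Q \<phi> < \<infinity>"
    and "inexact_primal_dual f Q \<phi> \<epsilon> x \<mu>"
  shows "\<bar>f (x n)\<bar> \<noteq> \<infinity>" and "\<bar>\<phi> (x n) (\<mu> n)\<bar> \<noteq> \<infinity>"
proof -
  have "dual_fun f Q \<phi> (\<mu> n) \<le> dual_value f Q \<phi>"
    unfolding dual_value_def by (rule SUP_upper) simp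
  then have "dual_fun f Q \<phi> (\<mu> n) + ereal (\<epsilon> n) < \<infinity>"
    using assms(3) by auto
  then have "f (x n) + \<phi> (x n) (\<mu> n) < \<infinity>"
    using inexact_minimizer_le_dual_fun[OF assms(4), of n] unfolding aug_fun_def by order
  then show "\<bar>f (x n)\<bar> \<noteq> \<infinity>" "\<bar>\<phi> (x n) (\<mu> n)\<bar> \<noteq> \<infinity>"
    using assms(1)[of "x n"] assms(2)[of "x n" "\<mu> n"] by auto
qed

theorem theorem1:
  fixes f :: "'a::metric_space \<Rightarrow> ereal"
    and Q :: "'a set"
    and \<Phi> :: "'a \<Rightarrow> 'b::real_normed_vector set"
    and \<phi> :: "'a \<Rightarrow> 'm::metric_space \<Rightarrow> ereal"
    and \<epsilon> :: "nat \<Rightarrow> real"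
    and x :: "nat \<Rightarrow> 'a"
    and \<mu> :: "nat \<Rightarrow> 'm"
    and eps :: ereal
  assumes f_proper: "\<And>z. f z \<noteq> -\<infinity>"
    and phi_proper: "\<And>z \<nu>. \<phi> z \<nu> \<noteq> -\<infinity>"
    and Q_nonempty: "Q \<noteq> {}"
    and Q_closed: "closed Q"
    and feasible: "feasible_set Q \<Phi> \<noteq> {}"
    and finite_value: "\<bar>opt_value f Q \<Phi>\<bar> \<noteq> \<infinity>"
    and weak_duality: "dual_value f Q \<phi> \<le> opt_value f Q \<Phi>"
    and generated: "inexact_primal_dual f Q \<phi> \<epsilon> x \<mu>"
    and eps_eq: "eps = limsup (\<lambda>n. ereal (\<epsilon> n))"
    and dist_to_zero: "(\<lambda>n. dist_zero (\<Phi> (x n))) \<longlonglongrightarrow> 0"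
    and liminf_phi: "liminf (\<lambda>n. \<phi> (x n) (\<mu> n)) \<ge> 0"
  shows
    "(lower_theta f Q \<Phi> \<le> liminf (\<lambda>n. f (x n)) \<and>
      liminf (\<lambda>n. f (x n)) \<le> limsup (\<lambda>n. f (x n)) \<and>
      limsup (\<lambda>n. f (x n)) \<le> upper_theta f Q \<Phi> \<phi> \<mu> + eps) \<and>
     (lower_theta f Q \<Phi> \<le> liminf (\<lambda>n. aug_fun f \<phi> (x n) (\<mu> n)) \<and>
      liminf (\<lambda>n. aug_fun f \<phi> (x n) (\<mu> n)) \<le> limsup (\<lambda>n. aug_fun f \<phi> (x n) (\<mu> n)) \<and>
      limsup (\<lambda>n. aug_fun f \<phi> (x n) (\<mu> n)) \<le> upper_theta f Q \<Phi> \<phi> \<mu> + eps) \<and>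
     (lower_theta f Q \<Phi> - eps \<le> liminf (\<lambda>n. dual_fun f Q \<phi> (\<mu> n)) \<and>
      liminf (\<lambda>n. dual_fun f Q \<phi> (\<mu> n)) \<le> limsup (\<lambda>n. dual_fun f Q \<phi> (\<mu> n)) \<and>
      limsup (\<lambda>n. dual_fun f Q \<phi> (\<mu> n)) \<le> upper_theta f Q \<Phi> \<phi> \<mu>) \<and>
     (lsc_within (perturbed_value f Q \<Phi>) 0 UNIV \<longrightarrow>
       lower_theta f Q \<Phi> = opt_value f Q \<Phi> \<and>
       upper_theta f Q \<Phi> \<phi> \<mu> = opt_value f Q \<Phi> \<and>
       limsup (\<lambda>n. \<phi> (x n) (\<mu> n)) \<le> eps \<and>
       (lsc_on Q f \<and> lsc_on Q (\<lambda>z. dist_zero (\<Phi> z)) \<and> (\<forall>z\<in>Q. closed (\<Phi> z)) \<longrightarrow>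
         (\<forall>z. seq_limit_point x z \<longrightarrow> eps_optimal_primal f Q \<Phi> eps z)) \<and>
       (usc_on UNIV (dual_fun f Q \<phi>) \<longrightarrow>
         (\<forall>\<nu>. seq_limit_point \<mu> \<nu> \<longrightarrow> eps_optimal_dual f Q \<phi> eps \<nu>)))"
proof -
  let ?\<theta> = "lower_theta f Q \<Phi>" and ?U = "upper_theta f Q \<Phi> \<phi> \<mu>" and ?v = "opt_value f Q \<Phi>"
  let ?F = "\<lambda>n. aug_fun f \<phi> (x n) (\<mu> n)" and ?\<Theta> = "\<lambda>n. dual_fun f Q \<phi> (\<mu> n)"
  have xQ: "x n \<in> Q" for n
    using generated by (simp add: inexact_primal_dual_def)
  have eps_finite: "\<bar>eps\<bar> \<noteq> \<infinity>"
    using inexact_primal_dual_limsup_finite[OF generated] unfolding eps_eq by auto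
  have "dual_value f Q \<phi> < \<infinity>"
    using weak_duality finite_value by auto
  note fin = inexact_primal_dual_finite[OF f_proper phi_proper this generated]
  have F_le: "?F n \<le> ?\<Theta> n + ereal (\<epsilon> n)" for n
    by (rule inexact_minimizer_le_dual_fun[OF generated])

  have low_f: "?\<theta> \<le> liminf (\<lambda>n. f (x n))"
    using xQ dist_to_zero by (rule lower_theta_le_liminf)
  have low_F: "?\<theta> \<le> liminf ?F"
  proof (cases "?\<theta> = -\<infinity>")
    case False
    \<comment> \<open>A lower value above \<open>-\<infinity>\<close> keeps the sum of the lower limits from being \<open>-\<infinity> + \<infinity>\<close>.\<close>
    have "?\<theta> + 0 \<le> liminf (\<lambda>n. f (x n)) + liminf (\<lambda>n. \<phi> (x n) (\<mu> n))"
      using low_f liminf_phi by (rule add_mono)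
    also have "\<dots> \<le> liminf ?F"
      unfolding aug_fun_def using False low_f liminf_phi by (intro ereal_liminf_add_mono) auto
    finally show ?thesis
      by simp
  qed simp
  have low_\<Theta>: "?\<theta> - eps \<le> liminf ?\<Theta>"
  proof -
    have "?\<theta> \<le> liminf (\<lambda>n. ?\<Theta> n + ereal (\<epsilon> n))"
      using low_F by (rule order_trans) (intro Liminf_mono always_eventually allI F_le)
    also have "\<dots> \<le> liminf ?\<Theta> + eps"
      unfolding eps_eq by (rule ereal_liminf_limsup_add)
    finally show ?thesis
      using eps_finite by (simp add: ereal_minus_le)
  qed

  have up_\<Theta>: "limsup ?\<Theta> \<le> ?U"
    using weak_duality by (rule limsup_dual_fun_le_upper_theta)
  have up_F: "limsup ?F \<le> ?U + eps"
  proof -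
    have "limsup ?F \<le> limsup (\<lambda>n. ?\<Theta> n + ereal (\<epsilon> n))"
      by (intro Limsup_mono always_eventually allI F_le)
    also have "\<dots> \<le> limsup ?\<Theta> + eps"
      unfolding eps_eq by (rule ereal_limsup_add_mono)
    also have "\<dots> \<le> ?U + eps"
      by (intro add_right_mono up_\<Theta>)
    finally show ?thesis .
  qed
  have up_f: "limsup (\<lambda>n. f (x n)) \<le> ?U + eps"
  proof -
    have "limsup (\<lambda>n. f (x n)) \<le> limsup ?F - liminf (\<lambda>n. \<phi> (x n) (\<mu> n))"
      unfolding aug_fun_def by (rule limsup_le_limsup_add_minus_liminf) (rule fin)
    also have "\<dots> \<le> limsup ?F - 0"
      using liminf_phi by (intro ereal_minus_mono) auto
    finally show ?thesis
      using up_F by simp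
  qed

  have lsc_case: "?\<theta> = ?v \<and> ?U = ?v \<and> limsup (\<lambda>n. \<phi> (x n) (\<mu> n)) \<le> eps \<and>
      (lsc_on Q f \<and> lsc_on Q (\<lambda>z. dist_zero (\<Phi> z)) \<and> (\<forall>z\<in>Q. closed (\<Phi> z)) \<longrightarrow>
         (\<forall>z. seq_limit_point x z \<longrightarrow> eps_optimal_primal f Q \<Phi> eps z)) \<and>
      (usc_on UNIV (dual_fun f Q \<phi>) \<longrightarrow>
         (\<forall>\<nu>. seq_limit_point \<mu> \<nu> \<longrightarrow> eps_optimal_dual f Q \<phi> eps \<nu>))"
    if "lsc_within (perturbed_value f Q \<Phi>) 0 UNIV"
  proof (intro conjI impI allI)
    show \<theta>: "?\<theta> = ?v"
      using that by (rule lower_theta_eq_opt_value)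
    then show U: "?U = ?v"
      by (simp add: upper_theta_def)
    show "limsup (\<lambda>n. \<phi> (x n) (\<mu> n)) \<le> eps"
    proof -
      have "limsup (\<lambda>n. \<phi> (x n) (\<mu> n)) \<le> limsup ?F - liminf (\<lambda>n. f (x n))"
        unfolding aug_fun_def add.commute[of "f _"]
        by (rule limsup_le_limsup_add_minus_liminf) (rule fin)
      also have "\<dots> \<le> (?v + eps) - ?v"
        using up_F low_f unfolding \<theta> U by (rule ereal_minus_mono)
      also have "\<dots> = eps"
        using finite_value by (cases ?v; cases eps) auto
      finally show ?thesis .
    qed
    show "eps_optimal_primal f Q \<Phi> eps z"
      if hyps: "lsc_on Q f \<and> lsc_on Q (\<lambda>z. dist_zero (\<Phi> z)) \<and> (\<forall>z\<in>Q. closed (\<Phi> z))"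
        and lim: "seq_limit_point x z" for z
    proof -
      obtain r where r: "strict_mono r" "(x \<circ> r) \<longlonglongrightarrow> z"
        using lim unfolding seq_limit_point_def by blast
      have rQ: "(x \<circ> r) n \<in> Q" for n
        using xQ by simp
      have zQ: "z \<in> Q"
        using Q_closed rQ r(2) by (rule closed_sequentially)
      have lim_le: "g z \<le> limsup (\<lambda>n. g (x n))" if "lsc_on Q g" for g
      proof -
        have "g z \<le> liminf (\<lambda>n. g ((x \<circ> r) n))"
          using that zQ unfolding lsc_on_def by (intro lsc_within_le_liminf[OF _ rQ r(2)]) blast
        also have "\<dots> \<le> limsup (\<lambda>n. g ((x \<circ> r) n))"
          by (rule Liminf_le_Limsup) simp
        also have "\<dots> \<le> limsup (\<lambda>n. g (x n))"
          using limsup_subseq_mono[OF r(1), of "\<lambda>n. g (x n)"] by (simp add: o_def)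
        finally show ?thesis .
      qed
      have "dist_zero (\<Phi> z) \<le> 0"
        using lim_le[of "\<lambda>z. dist_zero (\<Phi> z)"] hyps lim_imp_Limsup[OF _ dist_to_zero] by simp
      then have "z \<in> feasible_set Q \<Phi>"
        using closed_dist_zero_le_0D hyps zQ unfolding feasible_set_def by blast
      moreover have "f z \<le> ?v + eps"
        using lim_le[of f] hyps up_f unfolding U by auto
      ultimately show ?thesis
        unfolding eps_optimal_primal_def by blast
    qed
    show "eps_optimal_dual f Q \<phi> eps \<nu>"
      if usc: "usc_on UNIV (dual_fun f Q \<phi>)" and lim: "seq_limit_point \<mu> \<nu>" for \<nu>
    proof -
      obtain r where r: "strict_mono r" "(\<mu> \<circ> r) \<longlonglongrightarrow> \<nu>"
        using lim unfolding seq_limit_point_def by blast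
      have "dual_value f Q \<phi> - eps \<le> ?v - eps"
        using weak_duality by (intro ereal_minus_mono) auto
      also have "\<dots> \<le> liminf ?\<Theta>"
        using low_\<Theta> unfolding \<theta> .
      also have "\<dots> \<le> liminf (?\<Theta> \<circ> r)"
        using r(1) by (rule liminf_subseq_mono)
      also have "\<dots> \<le> limsup (?\<Theta> \<circ> r)"
        by (rule Liminf_le_Limsup) simp
      also have "\<dots> \<le> dual_fun f Q \<phi> \<nu>"
        using usc_within_limsup_le[of "dual_fun f Q \<phi>" \<nu> UNIV "\<mu> \<circ> r"] usc r(2)
        by (simp add: usc_on_def o_def)
      finally show ?thesis
        unfolding eps_optimal_dual_def .
    qed
  qed

  have "liminf u \<le> limsup u" for u :: "nat \<Rightarrow> ereal"
    by (rule Liminf_le_Limsup) simp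
  with low_f up_f low_F up_F low_\<Theta> up_\<Theta> lsc_case show ?thesis
    by blast
qed

end
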